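(* There is an absolute constant $C_1>0$ such that for every $p$ with $1<p\le 2$, $$ \sup_{\boldsymbol{\omega}\in\mathbb{R}^2}\|\boldsymbol{\omega}\|_2^{3/2}\,|\widehat{\chi_{B_p}}(\boldsymbol{\omega})|\le\frac{C_1}{\sqrt{p-1}}. $$ This estimate is sharp in the following sense: there is an absolute constant $C_2>0$ such that for every $p\in(1,2)$ there exists a sequence $\{\boldsymbol{\omega}_n\}\subset\mathbb{R}^2$ with $\|\boldsymbol{\omega}_n\|_2\to\infty$ such that $$ \|\boldsymbol{\omega}_n\|_2^{3/2}\,|\widehat{\chi_{B_p}}(\boldsymbol{\omega}_n)|\ge\frac{C_2}{\sqrt{p-1}}+o(1), $$ where $o(1)$ denotes a term tending to $0$ as $n\to\infty$ (for fixed $p$).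
   Context: For $p\ge 1$ and $\boldsymbol{x}=(x,y)\in\mathbb{R}^2$, $\|\boldsymbol{x}\|_p=(|x|^p+|y|^p)^{1/p}$, and $B_p=\{\boldsymbol{x}\in\mathbb{R}^2:\|\boldsymbol{x}\|_p\le 1\}$; $\chi_A$ denotes the characteristic function of a set $A$. The Fourier transform of $f\in L^1(\mathbb{R}^2)$ is $$\widehat{f}(\boldsymbol{\omega})=\widehat f(\alpha,\beta)=\frac{1}{2\pi}\iint_{\mathbb{R}^2}e^{-i(x\alpha+y\beta)}f(x,y)\,dx\,dy,\qquad \boldsymbol{\omega}=(\alpha,\beta)\in\mathbb{R}^2.$$ "Absolute constant" means a constant independent of all parameters, in particular of $p$. *)

theory Defs
  imports "HOL-Analysis.Analysis"
begin

definition pnorm :: "real \<Rightarrow> real \<times> real \<Rightarrow> real" where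
  "pnorm p v = (\<bar>fst v\<bar> powr p + \<bar>snd v\<bar> powr p) powr (1 / p)"

definition pball :: "real \<Rightarrow> (real \<times> real) set" where
  "pball p = {v. pnorm p v \<le> 1}"

text \<open>The inner product on the product type is \<open>(x, y) \<bullet> (\<alpha>, \<beta>) = x * \<alpha> + y * \<beta>\<close>.
  As usual for the Bochner integral, the value is meaningful only for integrable \<open>f\<close>.\<close>

definition fourier2 :: "(real \<times> real \<Rightarrow> complex) \<Rightarrow> real \<times> real \<Rightarrow> complex" where
  "fourier2 f \<omega> =
     1 / (2 * of_real pi) * (LINT v|lborel. exp (- (\<i> * of_real (v \<bullet> \<omega>))) * f v)"

lemma pnorm_2_eq_norm: "pnorm 2 v = norm v"
  by (cases v) (simp add: pnorm_def norm_Pair powr_half_sqrt)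

end

theory Submission
  imports Defs
begin

text \<open>Write the arc of the unit sphere in the first quadrant as \<open>x = h y\<close> with
  \<open>h y = (1 - y powr p) powr (1/p)\<close>. Integrating in \<open>x\<close> first turns the Fourier transform at
  \<open>(\<alpha>, \<beta>)\<close> into \<open>2 / (\<pi> \<alpha>)\<close> times the integral of \<open>cos (\<beta> y) sin (\<alpha> h y)\<close> over \<open>[0, 1]\<close>.
  By symmetry \<open>\<bar>\<beta>\<bar> \<le> \<bar>\<alpha>\<bar>\<close>, and since \<open>h'' \<le> - (p - 1)\<close>, van der Corput's second derivative test
  gives the upper bound.

  For sharpness take \<open>\<alpha> = \<beta>\<close>, so that the phase \<open>h y + y\<close> has its maximum \<open>M = 2 powr (1 - 1/p)\<close> on
  the diagonal, where \<open>\<bar>h''\<bar>\<close> is of order \<open>p - 1\<close>. Stationary phase asymptotics are avoided by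
  averaging: integrating against \<open>(R - \<alpha>) sin (\<alpha> M)\<close> over \<open>[0, R]\<close> produces the nonnegative Fejer
  kernel at \<open>M - h y - y\<close>, which is of size \<open>R\<^sup>2\<close> on a set of \<open>y\<close> of length of order
  \<open>1 / sqrt (R (p - 1))\<close>, up to terms bounded in \<open>R\<close>. This would be impossible if the integral were
  eventually below a small multiple of \<open>1 / sqrt (\<alpha> (p - 1))\<close>.\<close>

subsection \<open>Van der Corput estimates\<close>

text \<open>Integration by parts after writing \<open>sin \<phi>\<close> as
  \<open>(\<phi>' sin \<phi>) / \<phi>'\<close>. The two boundary values of
  \<open>- cos \<phi> / \<phi>'\<close> cost at most \<open>1 / \<delta>\<close> each. The remaining
  integral is at most the total variation of \<open>1 / \<phi>'\<close>, which is monotone because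
  \<open>\<phi>'' \<le> 0\<close> and takes values in \<open>[0, 1 / \<delta>]\<close>; this is the
  third \<open>1 / \<delta>\<close>.\<close>

lemma integral_sin_first_derivative_bound:
  fixes \<phi> \<phi>' \<phi>'' :: "real \<Rightarrow> real"
  assumes "a \<le> b" "\<delta> > 0"
    and \<phi>: "\<And>y. y \<in> {a..b} \<Longrightarrow> (\<phi> has_real_derivative \<phi>' y) (at y)"
    and \<phi>': "\<And>y. y \<in> {a..b} \<Longrightarrow> (\<phi>' has_real_derivative \<phi>'' y) (at y)"
    and nonpos: "\<And>y. y \<in> {a..b} \<Longrightarrow> \<phi>'' y \<le> 0"
    and large: "\<And>y. y \<in> {a..b} \<Longrightarrow> \<phi>' y \<ge> \<delta>"
  shows "\<bar>integral {a..b} (\<lambda>y. sin (\<phi> y))\<bar> \<le> 3 / \<delta>"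
proof -
  define F where "F y = - cos (\<phi> y) / \<phi>' y" for y
  define G where "G y = 1 / \<phi>' y" for y
  have nz: "\<phi>' y \<noteq> 0" if "y \<in> {a..b}" for y using large[OF that] \<open>\<delta> > 0\<close> by linarith
  have "((\<lambda>y. sin (\<phi> y) + cos (\<phi> y) * \<phi>'' y / (\<phi>' y)\<^sup>2) has_integral (F b - F a)) {a..b}"
  proof (rule fundamental_theorem_of_calculus[OF \<open>a \<le> b\<close>])
    fix y assume y: "y \<in> {a..b}"
    have "(F has_real_derivative (sin (\<phi> y) + cos (\<phi> y) * \<phi>'' y / (\<phi>' y)\<^sup>2)) (at y)"
      unfolding F_def using nz[OF y]
      by (auto intro!: derivative_eq_intros \<phi>[OF y] \<phi>'[OF y] simp: power2_eq_square field_simps)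
    then show "(F has_vector_derivative (sin (\<phi> y) + cos (\<phi> y) * \<phi>'' y / (\<phi>' y)\<^sup>2)) (at y within {a..b})"
      using has_real_derivative_iff_has_vector_derivative has_vector_derivative_at_within by blast
  qed
  moreover have "continuous_on {a..b} \<phi>"
    using \<phi> by (intro continuous_at_imp_continuous_on) (blast intro: DERIV_isCont)
  then have s: "(\<lambda>y. sin (\<phi> y)) integrable_on {a..b}"
    by (intro integrable_continuous_real continuous_intros)
  ultimately have rest: "((\<lambda>y. cos (\<phi> y) * \<phi>'' y / (\<phi>' y)\<^sup>2) has_integral
      (F b - F a - integral {a..b} (\<lambda>y. sin (\<phi> y)))) {a..b}"
    using has_integral_diff[OF _ integrable_integral[OF s]] by fastforce
  \<comment> \<open>The majorant of the remainder is an exact derivative, so its integral is known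
    without any estimate on the size of \<open>\<phi>''\<close>.\<close>
  have var: "((\<lambda>y. - \<phi>'' y / (\<phi>' y)\<^sup>2) has_integral (G b - G a)) {a..b}"
  proof (rule fundamental_theorem_of_calculus[OF \<open>a \<le> b\<close>])
    fix y assume y: "y \<in> {a..b}"
    have "(G has_real_derivative (- \<phi>'' y / (\<phi>' y)\<^sup>2)) (at y)"
      unfolding G_def using nz[OF y]
      by (auto intro!: derivative_eq_intros \<phi>'[OF y] simp: power2_eq_square field_simps)
    then show "(G has_vector_derivative (- \<phi>'' y / (\<phi>' y)\<^sup>2)) (at y within {a..b})"
      using has_real_derivative_iff_has_vector_derivative has_vector_derivative_at_within by blast
  qed
  have "norm (integral {a..b} (\<lambda>y. cos (\<phi> y) * \<phi>'' y / (\<phi>' y)\<^sup>2))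
      \<le> integral {a..b} (\<lambda>y. - \<phi>'' y / (\<phi>' y)\<^sup>2)"
  proof (rule integral_norm_bound_integral)
    fix y assume y: "y \<in> {a..b}"
    have "\<bar>cos (\<phi> y)\<bar> * \<bar>\<phi>'' y\<bar> \<le> 1 * \<bar>\<phi>'' y\<bar>" by (intro mult_right_mono) auto
    then show "norm (cos (\<phi> y) * \<phi>'' y / (\<phi>' y)\<^sup>2) \<le> - \<phi>'' y / (\<phi>' y)\<^sup>2"
      using nonpos[OF y] by (auto simp: abs_mult intro!: divide_right_mono)
  qed (use rest var in blast)+
  then have "\<bar>F b - F a - integral {a..b} (\<lambda>y. sin (\<phi> y))\<bar> \<le> G b - G a"
    using integral_unique[OF rest] integral_unique[OF var] by simp
  moreover have "\<bar>F y\<bar> \<le> 1 / \<delta>" "0 \<le> G y" "G y \<le> 1 / \<delta>" if "y \<in> {a..b}" for y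
  proof -
    show "0 \<le> G y" "G y \<le> 1 / \<delta>" unfolding G_def using large[OF that] \<open>\<delta> > 0\<close> by (auto simp: field_simps)
    have "\<bar>F y\<bar> \<le> G y" unfolding F_def G_def using large[OF that] \<open>\<delta> > 0\<close>
      by (auto simp: abs_divide divide_right_mono)
    with \<open>G y \<le> 1 / \<delta>\<close> show "\<bar>F y\<bar> \<le> 1 / \<delta>" by simp
  qed
  from this[of a] this[of b] have "\<bar>F a\<bar> \<le> 1/\<delta>" "\<bar>F b\<bar> \<le> 1/\<delta>" "0 \<le> G a" "G b \<le> 1/\<delta>"
    using \<open>a \<le> b\<close> by auto
  ultimately have "\<bar>integral {a..b} (\<lambda>y. sin (\<phi> y))\<bar> \<le> 1/\<delta> + 1/\<delta> + 1/\<delta>" by linarith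
  then show ?thesis by simp
qed

lemma integral_sin_abs_le_length:
  fixes \<phi> :: "real \<Rightarrow> real"
  assumes "a \<le> b"
  shows "\<bar>integral {a..b} (\<lambda>y. sin (\<phi> y))\<bar> \<le> b - a"
proof (cases "(\<lambda>y. sin (\<phi> y)) integrable_on {a..b}")
  case True
  have "norm (integral {a..b} (\<lambda>y. sin (\<phi> y))) \<le> integral {a..b} (\<lambda>y. 1)"
    by (rule integral_norm_bound_integral) (use True in auto)
  with assms show ?thesis by simp
next
  case False
  \<comment> \<open>The integral of a non-integrable function is 0 by convention, so no
    integrability hypothesis is required.\<close>
  with assms show ?thesis by (simp add: not_integrable_integral)
qed

text \<open>Since \<open>\<phi>'\<close> falls at rate at least \<open>\<kappa>\<close> and is still
  nonnegative at \<open>c\<close>, it is at least \<open>sqrt \<kappa>\<close> at distance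
  \<open>1 / sqrt \<kappa>\<close> or more to the left of \<open>c\<close>. There the first
  derivative test gives \<open>3 / sqrt \<kappa>\<close>; the last piece is bounded by its
  length.\<close>

lemma integral_sin_concave_increasing_bound:
  fixes \<phi> \<phi>' \<phi>'' :: "real \<Rightarrow> real"
  assumes "a \<le> c" "\<kappa> > 0"
    and \<phi>: "\<And>y. y \<in> {a..c} \<Longrightarrow> (\<phi> has_real_derivative \<phi>' y) (at y)"
    and \<phi>': "\<And>y. y \<in> {a..c} \<Longrightarrow> (\<phi>' has_real_derivative \<phi>'' y) (at y)"
    and concave: "\<And>y. y \<in> {a..c} \<Longrightarrow> \<phi>'' y \<le> - \<kappa>"
    and nonneg: "\<phi>' c \<ge> 0"
  shows "\<bar>integral {a..c} (\<lambda>y. sin (\<phi> y))\<bar> \<le> 4 / sqrt \<kappa>"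
proof (cases "c - a \<le> 1 / sqrt \<kappa>")
  case True
  have "1 / sqrt \<kappa> \<le> 4 / sqrt \<kappa>" using \<open>\<kappa> > 0\<close> by (simp add: field_simps)
  with True show ?thesis using integral_sin_abs_le_length[OF \<open>a \<le> c\<close>, of \<phi>] by linarith
next
  case False
  \<comment> \<open>Cutting at distance d from \<open>c\<close> costs
    \<open>3 / (\<kappa> d) + d\<close>; the choice d = \<open>1 / sqrt \<kappa>\<close> makes both
    terms of the same order.\<close>
  define m where "m = c - 1 / sqrt \<kappa>"
  have m: "a \<le> m" "m \<le> c" using False \<open>\<kappa> > 0\<close> by (auto simp: m_def)
  have "\<kappa> / sqrt \<kappa> = sqrt \<kappa>" using \<open>\<kappa> > 0\<close> by (simp add: real_div_sqrt)
  have large: "\<phi>' y \<ge> sqrt \<kappa>" if y: "y \<in> {a..m}" for y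
  proof -
    have yc: "y < c" using y \<open>\<kappa> > 0\<close> by (auto simp: m_def intro: le_less_trans)
    obtain z where z: "y < z" "z < c" "\<phi>' c - \<phi>' y = (c - y) * \<phi>'' z"
      using MVT2[OF yc, of \<phi>' \<phi>''] \<phi>' y by auto
    have "\<phi>'' z \<le> - \<kappa>" using z y by (intro concave) auto
    then have "(c - y) * \<phi>'' z \<le> (c - y) * (- \<kappa>)" using yc by (intro mult_left_mono) auto
    moreover have "(c - y) * \<kappa> \<ge> (1 / sqrt \<kappa>) * \<kappa>"
      using y \<open>\<kappa> > 0\<close> by (intro mult_right_mono) (auto simp: m_def)
    ultimately show ?thesis using z nonneg \<open>\<kappa> / sqrt \<kappa> = sqrt \<kappa>\<close> by (simp add: algebra_simps)
  qed
  have "continuous_on {a..c} \<phi>"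
    using \<phi> by (intro continuous_at_imp_continuous_on) (blast intro: DERIV_isCont)
  then have s: "(\<lambda>y. sin (\<phi> y)) integrable_on {a..c}"
    by (intro integrable_continuous_real continuous_intros)
  have "\<bar>integral {a..m} (\<lambda>y. sin (\<phi> y))\<bar> \<le> 3 / sqrt \<kappa>"
    by (rule integral_sin_first_derivative_bound[of a m "sqrt \<kappa>" \<phi> \<phi>' \<phi>''])
      (use m \<open>\<kappa> > 0\<close> \<phi> \<phi>' concave large in \<open>force+\<close>)
  moreover have "\<bar>integral {m..c} (\<lambda>y. sin (\<phi> y))\<bar> \<le> 1 / sqrt \<kappa>"
    using integral_sin_abs_le_length[OF m(2), of \<phi>] by (simp add: m_def)
  moreover have "integral {a..m} (\<lambda>y. sin (\<phi> y)) + integral {m..c} (\<lambda>y. sin (\<phi> y))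
      = integral {a..c} (\<lambda>y. sin (\<phi> y))"
    by (rule Henstock_Kurzweil_Integration.integral_combine[OF m s])
  ultimately have "\<bar>integral {a..c} (\<lambda>y. sin (\<phi> y))\<bar> \<le> 3 / sqrt \<kappa> + 1 / sqrt \<kappa>" by linarith
  then show ?thesis by simp
qed

text \<open>The reflection \<open>y\<close> to \<open>- y\<close> negates the first derivative and
  keeps the second, which turns this into the increasing case.\<close>

lemma integral_sin_concave_decreasing_bound:
  fixes \<phi> \<phi>' \<phi>'' :: "real \<Rightarrow> real"
  assumes "c \<le> b" "\<kappa> > 0"
    and \<phi>: "\<And>y. y \<in> {c..b} \<Longrightarrow> (\<phi> has_real_derivative \<phi>' y) (at y)"
    and \<phi>': "\<And>y. y \<in> {c..b} \<Longrightarrow> (\<phi>' has_real_derivative \<phi>'' y) (at y)"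
    and concave: "\<And>y. y \<in> {c..b} \<Longrightarrow> \<phi>'' y \<le> - \<kappa>"
    and nonpos: "\<phi>' c \<le> 0"
  shows "\<bar>integral {c..b} (\<lambda>y. sin (\<phi> y))\<bar> \<le> 4 / sqrt \<kappa>"
proof -
  have mirror: "((\<lambda>y. f (- y)) has_real_derivative - D) (at y)"
    if "(f has_real_derivative D) (at (- y))" for f and D y :: real
    using DERIV_mirror[of f "-y" D] DERIV_mirror[of f D y] that by (simp add: DERIV_mirror)
  have "\<bar>integral {-b..-c} (\<lambda>y. sin (\<phi> (- y)))\<bar> \<le> 4 / sqrt \<kappa>"
  proof (rule integral_sin_concave_increasing_bound[of "-b" "-c" \<kappa> _ "\<lambda>y. - \<phi>' (- y)" "\<lambda>y. \<phi>'' (- y)"])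
    fix y assume y: "y \<in> {-b..-c}"
    then have y': "- y \<in> {c..b}" by auto
    show "((\<lambda>y. \<phi> (- y)) has_real_derivative - \<phi>' (- y)) (at y)"
      by (rule mirror[OF \<phi>[OF y']])
    show "((\<lambda>y. - \<phi>' (- y)) has_real_derivative \<phi>'' (- y)) (at y)"
      using DERIV_minus[OF mirror[OF \<phi>'[OF y']]] by simp
    show "\<phi>'' (- y) \<le> - \<kappa>" by (rule concave[OF y'])
  qed (use assms in auto)
  also have "integral {-b..-c} (\<lambda>y. sin (\<phi> (- y))) = integral {c..b} (\<lambda>y. sin (\<phi> y))"
    by (rule Henstock_Kurzweil_Integration.integral_reflect_real[where f = "\<lambda>y. sin (\<phi> y)"])
  finally show ?thesis .
qed

text \<open>Van der Corput's second derivative test. As \<open>\<phi>'\<close> is strictly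
  decreasing it changes sign at most once; the interval is cut at the zero, and each side
  contributes at most \<open>4 / sqrt \<kappa>\<close>.\<close>

lemma integral_sin_second_derivative_bound:
  fixes \<phi> \<phi>' \<phi>'' :: "real \<Rightarrow> real"
  assumes "a \<le> b" "\<kappa> > 0"
    and \<phi>: "\<And>y. y \<in> {a..b} \<Longrightarrow> (\<phi> has_real_derivative \<phi>' y) (at y)"
    and \<phi>': "\<And>y. y \<in> {a..b} \<Longrightarrow> (\<phi>' has_real_derivative \<phi>'' y) (at y)"
    and concave: "\<And>y. y \<in> {a..b} \<Longrightarrow> \<phi>'' y \<le> - \<kappa>"
  shows "\<bar>integral {a..b} (\<lambda>y. sin (\<phi> y))\<bar> \<le> 8 / sqrt \<kappa>"
proof -
  have pos: "4 / sqrt \<kappa> > 0" using \<open>\<kappa> > 0\<close> by simp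
  consider "\<phi>' b \<ge> 0" | "\<phi>' a \<le> 0" | "\<phi>' a > 0" "\<phi>' b < 0" by linarith
  then show ?thesis
  proof cases
    case 1
    then have "\<bar>integral {a..b} (\<lambda>y. sin (\<phi> y))\<bar> \<le> 4 / sqrt \<kappa>"
      using integral_sin_concave_increasing_bound[of a b \<kappa> \<phi> \<phi>' \<phi>''] assms by blast
    with pos show ?thesis by simp
  next
    case 2
    then have "\<bar>integral {a..b} (\<lambda>y. sin (\<phi> y))\<bar> \<le> 4 / sqrt \<kappa>"
      using integral_sin_concave_decreasing_bound[of a b \<kappa> \<phi> \<phi>' \<phi>''] assms by blast
    with pos show ?thesis by simp
  next
    case 3
    have "continuous_on {a..b} \<phi>'"
      using \<phi>' by (intro continuous_at_imp_continuous_on) (blast intro: DERIV_isCont)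
    then obtain c where c: "a \<le> c" "c \<le> b" "\<phi>' c = 0"
      using IVT2'[of \<phi>' b 0 a] 3 \<open>a \<le> b\<close> by auto
    have "continuous_on {a..b} \<phi>"
      using \<phi> by (intro continuous_at_imp_continuous_on) (blast intro: DERIV_isCont)
    then have s: "(\<lambda>y. sin (\<phi> y)) integrable_on {a..b}"
      by (intro integrable_continuous_real continuous_intros)
    have "\<bar>integral {a..c} (\<lambda>y. sin (\<phi> y))\<bar> \<le> 4 / sqrt \<kappa>"
      by (rule integral_sin_concave_increasing_bound[of a c \<kappa> \<phi> \<phi>' \<phi>'']) (use assms c in auto)
    moreover have "\<bar>integral {c..b} (\<lambda>y. sin (\<phi> y))\<bar> \<le> 4 / sqrt \<kappa>"
      by (rule integral_sin_concave_decreasing_bound[of c b \<kappa> \<phi> \<phi>' \<phi>'']) (use assms c in auto)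
    ultimately show ?thesis
      using Henstock_Kurzweil_Integration.integral_combine[OF c(1,2) s] by linarith
  qed
qed

text \<open>The form needed for the arc, whose second derivative blows up at 0 when
  \<open>p < 2\<close> and whose slope blows up at 1. Removing short end pieces costs only their
  length, while the bound on the middle does not depend on how much is removed.\<close>

lemma integral_sin_second_derivative_bound_open:
  fixes \<phi> \<phi>' \<phi>'' :: "real \<Rightarrow> real"
  assumes "a < b" "\<kappa> > 0" and cont: "continuous_on {a..b} \<phi>"
    and \<phi>: "\<And>y. y \<in> {a<..<b} \<Longrightarrow> (\<phi> has_real_derivative \<phi>' y) (at y)"
    and \<phi>': "\<And>y. y \<in> {a<..<b} \<Longrightarrow> (\<phi>' has_real_derivative \<phi>'' y) (at y)"
    and concave: "\<And>y. y \<in> {a<..<b} \<Longrightarrow> \<phi>'' y \<le> - \<kappa>"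
  shows "\<bar>integral {a..b} (\<lambda>y. sin (\<phi> y))\<bar> \<le> 8 / sqrt \<kappa>"
proof (rule field_le_epsilon)
  fix e :: real assume "e > 0"
  \<comment> \<open>The two end pieces together cost at most \<open>e\<close>, and the middle
    interval does not become reversed.\<close>
  define t where "t = min (e / 2) ((b - a) / 2)"
  have t: "0 < t" "2 * t \<le> e" "a + t \<le> b - t"
    using \<open>e > 0\<close> \<open>a < b\<close> unfolding t_def by (auto simp: min_def field_simps)
  let ?f = "\<lambda>y. sin (\<phi> y)"
  have s: "?f integrable_on {a..b}"
    by (intro integrable_continuous_real continuous_intros cont)
  have s': "?f integrable_on {a..b - t}"
    by (rule integrable_subinterval_real[OF s]) (use t in auto)
  have "integral {a..a+t} ?f + integral {a+t..b-t} ?f = integral {a..b-t} ?f"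
    using t by (intro Henstock_Kurzweil_Integration.integral_combine s') auto
  moreover have "integral {a..b-t} ?f + integral {b-t..b} ?f = integral {a..b} ?f"
    using t by (intro Henstock_Kurzweil_Integration.integral_combine s) auto
  moreover have "\<bar>integral {a..a+t} ?f\<bar> \<le> t" "\<bar>integral {b-t..b} ?f\<bar> \<le> t"
    using integral_sin_abs_le_length[of a "a+t" \<phi>] integral_sin_abs_le_length[of "b-t" b \<phi>] t by auto
  moreover have "\<bar>integral {a+t..b-t} ?f\<bar> \<le> 8 / sqrt \<kappa>"
    by (rule integral_sin_second_derivative_bound[of _ _ \<kappa> \<phi> \<phi>' \<phi>'']) (use assms t in auto)
  ultimately show "\<bar>integral {a..b} ?f\<bar> \<le> 8 / sqrt \<kappa> + e" using t by linarith
qed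

subsection \<open>The boundary arc\<close>

text \<open>The function \<open>h\<close> of the overview. The convention
  \<open>0 powr (1 / p) = 0\<close> gives the correct endpoint value at
  \<open>y = 1\<close>.\<close>

definition lp_arc :: "real \<Rightarrow> real \<Rightarrow> real" where
  "lp_arc p y = (1 - y powr p) powr (1 / p)"

lemma powr_less_one_of_less_one:
  assumes "0 \<le> y" "y < 1" "0 < p" shows "y powr p < (1::real)"
  using powr_less_mono2[of p y 1] assms by simp

lemma continuous_on_lp_arc:
  assumes "p > 0" shows "continuous_on {0..1} (lp_arc p)"
  unfolding lp_arc_def using assms
  by (intro continuous_on_powr' continuous_intros) (auto intro: powr_le1)

lemma lp_arc_has_derivative:
  assumes "p > 0" "0 < y" "y < 1"
  shows "(lp_arc p has_real_derivative - ((1 - y powr p) powr (1 / p - 1) * y powr (p - 1))) (at y)"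
  unfolding lp_arc_def using assms powr_less_one_of_less_one[of y p]
  by (auto intro!: derivative_eq_intros simp: field_simps)

lemma lp_arc_has_second_derivative:
  assumes "p > 0" "0 < y" "y < 1"
  shows "((\<lambda>y. - ((1 - y powr p) powr (1 / p - 1) * y powr (p - 1))) has_real_derivative
     - ((p - 1) * y powr (p - 2) * (1 - y powr p) powr (1 / p - 2))) (at y)"
proof -
  let ?u = "1 - y powr p"
  have u: "?u > 0" using assms powr_less_one_of_less_one[of y p] by simp
  \<comment> \<open>Both terms of the product rule acquire the common factor
    \<open>(p - 1) * y powr (p - 2) * ?u powr (1 / p - 2)\<close>; the cofactors
    \<open>y powr p\<close> and \<open>?u\<close> then add up to 1.\<close>
  have 1: "?u powr (1 / p - 1) = ?u * ?u powr (1 / p - 2)"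
    using u powr_add[of ?u 1 "1/p - 2"] by simp
  have 2: "y powr (p - 1) * y powr (p - 1) = y powr p * y powr (p - 2)"
    using assms by (simp flip: powr_add)
  have "- ((1/p - 1) * ?u powr (1/p - 2) * (- (p * y powr (p - 1))) * y powr (p - 1)
      + ?u powr (1/p - 1) * ((p - 1) * y powr (p - 2)))
    = - ((p - 1) * ?u powr (1/p - 2) * (y powr (p - 1) * y powr (p - 1))
      + ?u powr (1/p - 1) * ((p - 1) * y powr (p - 2)))"
    using assms by (simp add: field_simps)
  also have "\<dots> = - ((p - 1) * y powr (p - 2) * ?u powr (1 / p - 2))"
    unfolding 1 2 by (simp add: algebra_simps)
  finally have eq: "- ((1/p - 1) * ?u powr (1/p - 2) * (- (p * y powr (p - 1))) * y powr (p - 1)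
      + ?u powr (1/p - 1) * ((p - 1) * y powr (p - 2)))
    = - ((p - 1) * y powr (p - 2) * ?u powr (1 / p - 2))" .
  show ?thesis unfolding eq[symmetric] using assms u
    by (auto intro!: derivative_eq_intros)
qed

text \<open>Both bases lie in (0, 1] and both exponents are at most 0, so each power is at least 1.
  This curvature bound is the source of the factor \<open>1 / sqrt (p - 1)\<close>.\<close>

lemma lp_arc_second_derivative_le:
  fixes p y :: real
  assumes "1 < p" "p \<le> 2" "0 < y" "y < 1"
  shows "- ((p - 1) * y powr (p - 2) * (1 - y powr p) powr (1 / p - 2)) \<le> - (p - 1)"
proof -
  let ?u = "1 - y powr p"
  have u: "?u > 0" "?u \<le> 1" using assms powr_less_one_of_less_one[of y p] by auto
  have "1 / p \<le> 1" using assms by simp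
  have "y powr (p - 2) \<ge> 1" using powr_mono2'[of "p - 2" y 1] assms by simp
  moreover have "?u powr (1 / p - 2) \<ge> 1"
    using powr_mono2'[of "1/p - 2" ?u 1] u \<open>1 / p \<le> 1\<close> by simp
  ultimately have "1 * 1 \<le> y powr (p - 2) * ?u powr (1 / p - 2)" by (intro mult_mono) auto
  then have "(p - 1) * 1 \<le> (p - 1) * (y powr (p - 2) * ?u powr (1 / p - 2))"
    using assms by (intro mult_left_mono) auto
  then show ?thesis by (simp add: mult.assoc)
qed

text \<open>The linear term \<open>\<beta> * y\<close> leaves the second derivative unchanged, so
  the test applies with \<open>\<alpha> * (p - 1)\<close> as curvature, uniformly in
  \<open>\<beta>\<close>.\<close>

lemma integral_sin_lp_arc_bound:
  assumes "1 < p" "p \<le> 2" "\<alpha> > 0"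
  shows "\<bar>integral {0..1} (\<lambda>y. sin (\<alpha> * lp_arc p y + \<beta> * y))\<bar> \<le> 8 / sqrt (\<alpha> * (p - 1))"
proof (rule integral_sin_second_derivative_bound_open[where
    \<phi>' = "\<lambda>y. \<alpha> * (- ((1 - y powr p) powr (1 / p - 1) * y powr (p - 1))) + \<beta>" and
    \<phi>'' = "\<lambda>y. \<alpha> * (- ((p - 1) * y powr (p - 2) * (1 - y powr p) powr (1 / p - 2)))"])
  show "continuous_on {0..1} (\<lambda>y. \<alpha> * lp_arc p y + \<beta> * y)"
    using assms by (intro continuous_intros continuous_on_lp_arc) auto
next
  fix y :: real assume y: "y \<in> {0<..<1}"
  show "((\<lambda>y. \<alpha> * lp_arc p y + \<beta> * y) has_real_derivative
      \<alpha> * (- ((1 - y powr p) powr (1 / p - 1) * y powr (p - 1))) + \<beta>) (at y)"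
    using assms y lp_arc_has_derivative[of p y]
    by (intro DERIV_add DERIV_cmult) (auto intro!: derivative_eq_intros)
  show "((\<lambda>y. \<alpha> * (- ((1 - y powr p) powr (1 / p - 1) * y powr (p - 1))) + \<beta>) has_real_derivative
      \<alpha> * (- ((p - 1) * y powr (p - 2) * (1 - y powr p) powr (1 / p - 2)))) (at y)"
    using DERIV_add[OF DERIV_cmult[OF lp_arc_has_second_derivative[of p y], of \<alpha>] DERIV_const[of \<beta>]]
      assms y by (simp only: add_0_right greaterThanLessThan_iff)
  show "\<alpha> * (- ((p - 1) * y powr (p - 2) * (1 - y powr p) powr (1 / p - 2))) \<le> - (\<alpha> * (p - 1))"
    using mult_left_mono[OF lp_arc_second_derivative_le[of p y], of \<alpha>] assms y
    by (simp only: greaterThanLessThan_iff mult_minus_right less_imp_le)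
qed (use assms in auto)

lemma continuous_on_cos_sin_lp_arc:
  assumes "p > 0"
  shows "continuous_on {0..1} (\<lambda>y. cos (\<beta> * y) * sin (\<alpha> * lp_arc p y))"
  by (intro continuous_intros continuous_on_lp_arc assms)

text \<open>Product-to-sum makes the integrand the mean of two sines with phases
  \<open>\<alpha> * lp_arc p y \<plusminus> \<beta> * y\<close>, each covered by the preceding
  bound.\<close>

lemma integral_cos_sin_lp_arc_bound:
  assumes "1 < p" "p \<le> 2" "\<alpha> > 0"
  shows "\<bar>integral {0..1} (\<lambda>y. cos (\<beta> * y) * sin (\<alpha> * lp_arc p y))\<bar> \<le> 8 / sqrt (\<alpha> * (p - 1))"
proof -
  have int: "(\<lambda>y. sin (\<alpha> * lp_arc p y + b * y)) integrable_on {0..1}" for b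
    using assms by (intro integrable_continuous_real continuous_intros continuous_on_lp_arc) auto
  have "integral {0..1} (\<lambda>y. cos (\<beta> * y) * sin (\<alpha> * lp_arc p y))
      = integral {0..1} (\<lambda>y. (1/2) * (sin (\<alpha> * lp_arc p y + \<beta> * y) + sin (\<alpha> * lp_arc p y + (- \<beta>) * y)))"
    by (intro integral_cong) (simp add: sin_add algebra_simps sin_diff)
  also have "\<dots> = (1/2) * (integral {0..1} (\<lambda>y. sin (\<alpha> * lp_arc p y + \<beta> * y))
      + integral {0..1} (\<lambda>y. sin (\<alpha> * lp_arc p y + (- \<beta>) * y)))"
    by (subst integral_mult_right) (simp only: integral_add[OF int int])
  finally show ?thesis
    using integral_sin_lp_arc_bound[OF assms, of \<beta>] integral_sin_lp_arc_bound[OF assms, of "-\<beta>"]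
    by argo
qed

lemma lp_arc_nonneg: "lp_arc p y \<ge> 0"
  by (simp add: lp_arc_def)

lemma lp_arc_le_1:
  assumes "p > 0" "0 \<le> y" "y \<le> 1" shows "lp_arc p y \<le> 1"
  unfolding lp_arc_def using assms powr_le1[of p y] by (intro powr_le1) auto

subsection \<open>Fourier transform of the ball\<close>

text \<open>For Fubini: the horizontal section of the ball at height \<open>y\<close> is a symmetric
  interval of half-length \<open>lp_arc p \<bar>y\<bar>\<close>.\<close>

lemma mem_pball_iff:
  assumes "p > 0"
  shows "(x, y) \<in> pball p \<longleftrightarrow> \<bar>y\<bar> \<le> 1 \<and> \<bar>x\<bar> \<le> lp_arc p \<bar>y\<bar>"
proof -
  have powr_le_1_iff: "s powr q \<le> 1 \<longleftrightarrow> s \<le> 1" if "s \<ge> 0" "q > 0" for s q :: real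
    using that powr_le1[of q s] gr_one_powr[of s q] by linarith
  have "(x, y) \<in> pball p \<longleftrightarrow> \<bar>x\<bar> powr p \<le> 1 - \<bar>y\<bar> powr p"
    using powr_le_1_iff[of "\<bar>x\<bar> powr p + \<bar>y\<bar> powr p" "1/p"] assms
    by (auto simp: pball_def pnorm_def)
  also have "\<dots> \<longleftrightarrow> \<bar>y\<bar> \<le> 1 \<and> \<bar>x\<bar> \<le> lp_arc p \<bar>y\<bar>"
  proof safe
    assume le: "\<bar>x\<bar> powr p \<le> 1 - \<bar>y\<bar> powr p"
    then have "\<bar>y\<bar> powr p \<le> 1" using powr_ge_zero[of "\<bar>x\<bar>" p] by linarith
    then show "\<bar>y\<bar> \<le> 1" using powr_le_1_iff[of "\<bar>y\<bar>" p] assms by simp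
    have "(\<bar>x\<bar> powr p) powr (1 / p) \<le> (1 - \<bar>y\<bar> powr p) powr (1 / p)"
      using le assms by (intro powr_mono2) auto
    then show "\<bar>x\<bar> \<le> lp_arc p \<bar>y\<bar>" using assms by (simp add: lp_arc_def powr_powr)
  next
    assume y: "\<bar>y\<bar> \<le> 1" and x: "\<bar>x\<bar> \<le> lp_arc p \<bar>y\<bar>"
    have "\<bar>x\<bar> powr p \<le> lp_arc p \<bar>y\<bar> powr p" using x assms by (intro powr_mono2) auto
    also have "\<dots> = 1 - \<bar>y\<bar> powr p"
      using assms y powr_le1[of p "\<bar>y\<bar>"] by (simp add: lp_arc_def powr_powr)
    finally show "\<bar>x\<bar> powr p \<le> 1 - \<bar>y\<bar> powr p" .
  qed
  finally show ?thesis .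
qed

lemma pball_borel: "pball p \<in> sets borel"
proof -
  have [measurable]: "fst \<in> borel_measurable (borel :: (real \<times> real) measure)"
    "snd \<in> borel_measurable (borel :: (real \<times> real) measure)"
    by (intro borel_measurable_continuous_onI continuous_intros)+
  have "{v \<in> space borel. (\<bar>fst v\<bar> powr p + \<bar>snd v\<bar> powr p) powr (1 / p) \<le> 1} \<in> sets borel"
    by measurable
  then show ?thesis by (simp add: pball_def pnorm_def)
qed

lemma integrable_fourier_pball:
  assumes "p > 0"
  shows "integrable lborel (\<lambda>v. exp (- (\<i> * of_real (v \<bullet> \<omega>))) * indicator (pball p) v :: complex)"
proof -
  have "pball p \<subseteq> cbox (-1, -1) (1, 1)"
  proof
    fix v assume v: "v \<in> pball p"
    obtain x y where [simp]: "v = (x, y)" by fastforce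
    have "\<bar>y\<bar> \<le> 1" "\<bar>x\<bar> \<le> lp_arc p \<bar>y\<bar>" using v mem_pball_iff[OF assms] by auto
    then have "\<bar>x\<bar> \<le> 1" "\<bar>y\<bar> \<le> 1" using lp_arc_le_1[OF assms, of "\<bar>y\<bar>"] by auto
    then show "v \<in> cbox (-1, -1) (1, 1)" by (auto simp: cbox_Pair_eq abs_le_iff)
  qed
  then have "bounded (pball p)" using bounded_cbox bounded_subset by blast
  then have fin: "emeasure lborel (pball p) < \<infinity>" by (rule emeasure_bounded_finite)
  have meas: "(\<lambda>v. exp (- (\<i> * of_real (v \<bullet> \<omega>))) :: complex) \<in> borel_measurable lborel"
    unfolding measurable_lborel2 by (intro borel_measurable_continuous_onI continuous_intros)
  have "integrable lborel (\<lambda>v. indicator (pball p) v *\<^sub>R (exp (- (\<i> * of_real (v \<bullet> \<omega>))) :: complex))"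
    by (rule integrableI_bounded_set_indicator[OF _ meas fin, of 1])
      (auto simp: pball_borel norm_exp_eq_Re)
  moreover have "(\<lambda>v. indicator (pball p) v *\<^sub>R (exp (- (\<i> * of_real (v \<bullet> \<omega>))) :: complex))
      = (\<lambda>v. exp (- (\<i> * of_real (v \<bullet> \<omega>))) * indicator (pball p) v)"
    by (auto simp: fun_eq_iff indicator_def)
  ultimately show ?thesis by simp
qed

lemma integral_exp_symmetric_interval:
  assumes "\<alpha> \<noteq> 0" "H \<ge> 0"
  shows "(LINT x|lborel. indicator {-H..H} x *\<^sub>R exp (- (\<i> * of_real (x * \<alpha>))))
    = of_real (2 * sin (\<alpha> * H) / \<alpha>)"
proof -
  let ?F = "\<lambda>x. (\<i> / of_real \<alpha>) * exp (- (\<i> * of_real (x * \<alpha>)))"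
  have "(LINT x|lborel. indicator {-H..H} x *\<^sub>R exp (- (\<i> * of_real (x * \<alpha>)))) = ?F H - ?F (-H)"
  proof (rule integral_FTC_atLeastAtMost)
    fix x
    have "((\<lambda>z. (\<i> / of_real \<alpha>) * exp (- (\<i> * (z * of_real \<alpha>)))) has_field_derivative
       exp (- (\<i> * (of_real x * of_real \<alpha>)))) (at (of_real x))"
      using assms by (auto intro!: derivative_eq_intros simp: field_simps)
    from has_vector_derivative_real_field[OF this]
    show "(?F has_vector_derivative exp (- (\<i> * of_real (x * \<alpha>)))) (at x within {-H..H})"
      by simp
  qed (use assms in \<open>auto intro!: continuous_intros\<close>)
  also have "\<dots> = of_real (2 * sin (\<alpha> * H) / \<alpha>)"
  proof -
    have "exp (- (\<i> * of_real (t * \<alpha>))) = of_real (cos (t * \<alpha>)) - \<i> * of_real (sin (t * \<alpha>))" for t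
      by (simp add: complex_eq_iff Re_exp Im_exp)
    then show ?thesis
      using assms by (simp add: complex_eq_iff Re_exp Im_exp mult.commute)
  qed
  finally show ?thesis .
qed

text \<open>Fubini with the inner integral over the symmetric section gives
  \<open>2 * sin (\<alpha> * lp_arc p \<bar>y\<bar>) / \<alpha>\<close>. Folding the outer integral
  onto [0, 1] leaves only the even part of the remaining exponential.\<close>

lemma fourier2_pball:
  assumes "p > 0" "\<alpha> \<noteq> 0"
  shows "fourier2 (indicator (pball p)) (\<alpha>, \<beta>)
    = of_real (2 / (pi * \<alpha>) * integral {0..1} (\<lambda>y. cos (\<beta> * y) * sin (\<alpha> * lp_arc p y)))"
proof -
  let ?f = "\<lambda>x y. exp (- (\<i> * of_real ((x, y) \<bullet> (\<alpha>, \<beta>)))) * indicator (pball p) (x, y) :: complex"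
  define g where "g y = exp (- (\<i> * of_real (y * \<beta>))) * of_real (2 * sin (\<alpha> * lp_arc p \<bar>y\<bar>) / \<alpha>)" for y
  define T where "T = integral {0..1} (\<lambda>y. cos (\<beta> * y) * sin (\<alpha> * lp_arc p y))"
  have inner: "(LINT x|lborel. ?f x y) = indicator {-1..1} y *\<^sub>R g y" for y
  proof (cases "\<bar>y\<bar> \<le> 1")
    case True
    have "(LINT x|lborel. ?f x y) = (LINT x|lborel. exp (- (\<i> * of_real (y * \<beta>)))
       * (indicator {- lp_arc p \<bar>y\<bar>..lp_arc p \<bar>y\<bar>} x *\<^sub>R exp (- (\<i> * of_real (x * \<alpha>)))))"
      using True mem_pball_iff[OF assms(1), of _ y]
      by (intro Bochner_Integration.integral_cong)
        (auto simp: indicator_def abs_le_iff algebra_simps simp flip: exp_add)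
    also have "\<dots> = g y"
      by (simp only: g_def integral_mult_right_zero
          integral_exp_symmetric_interval[OF assms(2) lp_arc_nonneg])
    finally show ?thesis using True by (simp add: indicator_def abs_le_iff)
  next
    case False
    then have "?f x y = 0" for x using mem_pball_iff[OF assms(1), of x y] by (simp add: indicator_def)
    with False show ?thesis by (auto simp: indicator_def)
  qed
  have cont: "continuous_on {-1..1} g"
    unfolding g_def using assms
    by (intro continuous_intros continuous_on_compose2[OF continuous_on_lp_arc[OF assms(1)]]) auto
  then have int: "g integrable_on {-1..1}" by (rule integrable_continuous_real)
  have contT: "continuous_on {0..1} (\<lambda>y. cos (\<beta> * y) * sin (\<alpha> * lp_arc p y))"
    by (rule continuous_on_cos_sin_lp_arc[OF assms(1)])
  have split_f: "case_prod ?f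
      = (\<lambda>v. exp (- (\<i> * of_real (v \<bullet> (\<alpha>, \<beta>)))) * indicator (pball p) v)"
    by (auto simp: fun_eq_iff)
  have "(LINT v|lborel. exp (- (\<i> * of_real (v \<bullet> (\<alpha>, \<beta>)))) * indicator (pball p) v)
      = (LINT y|lborel. LINT x|lborel. ?f x y)"
    by (rule lborel_pair.integral_snd[of ?f, unfolded split_f lborel_prod,
          OF integrable_fourier_pball[OF assms(1)], symmetric])
  also have "\<dots> = (LINT y:{-1..1}|lborel. g y)"
    by (simp only: inner set_lebesgue_integral_def)
  also have "\<dots> = integral {-1..1} g"
    using cont by (intro set_borel_integral_eq_integral borel_integrable_compact
        borel_integrable_atLeastAtMost' )
  also have "\<dots> = integral {-1..0} g + integral {0..1} g"
    by (rule Henstock_Kurzweil_Integration.integral_combine[symmetric]) (use int in auto)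
  also have "integral {-1..0} g = integral {0..1} (\<lambda>y. g (- y))"
    using Henstock_Kurzweil_Integration.integral_reflect_real[of 1 0 "\<lambda>y. g (-y)"] by simp
  also have "\<dots> + integral {0..1} g = integral {0..1} (\<lambda>y. g (- y) + g y)"
  proof (rule integral_add[symmetric])
    show "g integrable_on {0..1}" by (rule integrable_subinterval_real[OF int]) auto
    show "(\<lambda>y. g (- y)) integrable_on {0..1}"
      by (intro integrable_continuous_real continuous_on_compose2[OF cont] continuous_intros) auto
  qed
  \<comment> \<open>The imaginary sine parts at \<open>y\<close> and \<open>- y\<close> cancel and
    the cosines double, so \<open>2 / \<alpha>\<close> becomes \<open>4 / \<alpha>\<close>; the
    prefactor \<open>1 / (2 * pi)\<close> then gives \<open>2 / (pi * \<alpha>)\<close>.\<close>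
  also have "\<dots> = integral {0..1} (\<lambda>y. of_real (4 / \<alpha> * (cos (\<beta> * y) * sin (\<alpha> * lp_arc p y))))"
  proof (rule integral_cong)
    fix y :: real assume y: "y \<in> {0..1}"
    have e: "exp (- (\<i> * of_real t)) = of_real (cos t) - \<i> * of_real (sin t)" for t
      by (simp add: complex_eq_iff Re_exp Im_exp)
    show "g (- y) + g y = of_real (4 / \<alpha> * (cos (\<beta> * y) * sin (\<alpha> * lp_arc p y)))"
      unfolding g_def e using y by (simp add: complex_eq_iff mult.commute)
  qed
  also have "\<dots> = of_real (4 / \<alpha> * T)"
  proof -
    have "((\<lambda>y. 4 / \<alpha> * (cos (\<beta> * y) * sin (\<alpha> * lp_arc p y))) has_integral 4 / \<alpha> * T) {0..1}"
      unfolding T_def by (intro has_integral_mult_right integrable_integral integrable_continuous_real contT)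
    then show ?thesis by (intro integral_unique has_integral_of_real)
  qed
  finally show ?thesis unfolding fourier2_def T_def[symmetric] by simp
qed

text \<open>Exchanging the coordinates preserves both the ball and Lebesgue measure. This permits
  the reduction to \<open>\<bar>\<beta>\<bar> \<le> \<bar>\<alpha>\<bar>\<close>.\<close>

lemma fourier2_pball_swap:
  "fourier2 (indicator (pball p)) (\<alpha>, \<beta>) = fourier2 (indicator (pball p)) (\<beta>, \<alpha>)"
proof -
  let ?f = "\<lambda>\<omega> v. exp (- (\<i> * of_real (v \<bullet> \<omega>))) * indicator (pball p) v :: complex"
  have meas: "?f \<omega> \<in> borel_measurable (lborel \<Otimes>\<^sub>M lborel)" for \<omega>
  proof -
    have "?f \<omega> \<in> borel_measurable borel"
      using pball_borel by (intro borel_measurable_times borel_measurable_indicator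
          borel_measurable_continuous_onI continuous_intros)
    then show ?thesis by (simp add: lborel_prod)
  qed
  have "(LINT v|lborel. ?f (\<alpha>, \<beta>) v) = (LINT v|lborel. ?f (\<alpha>, \<beta>) (snd v, fst v))"
    using lborel_pair.integral_product_swap[OF meas, of "(\<alpha>, \<beta>)"]
    by (simp only: lborel_prod case_prod_beta')
  also have "\<dots> = (LINT v|lborel. ?f (\<beta>, \<alpha>) v)"
    by (intro Bochner_Integration.integral_cong)
      (auto simp: indicator_def pball_def pnorm_def add.commute)
  finally show ?thesis by (simp add: fourier2_def)
qed

text \<open>When \<open>\<alpha>\<close> is the dominant coordinate,
  \<open>norm (\<alpha>, \<beta>) powr (3/2)\<close> is comparable to
  \<open>\<bar>\<alpha>\<bar> powr (3/2)\<close>. This is cancelled by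
  \<open>1 / \<bar>\<alpha>\<bar>\<close> from the inner integration and
  \<open>1 / sqrt \<bar>\<alpha>\<bar>\<close> from van der Corput.\<close>

lemma fourier2_pball_bound:
  assumes p: "1 < p" "p \<le> 2" and ord: "\<bar>\<beta>\<bar> \<le> \<bar>\<alpha>\<bar>"
  shows "norm (\<alpha>, \<beta>) powr (3/2) * cmod (fourier2 (indicator (pball p)) (\<alpha>, \<beta>)) \<le> 16 / sqrt (p - 1)"
proof (cases "\<alpha> = 0")
  case True
  then show ?thesis using ord p by (simp add: norm_Pair)
next
  case False
  define a where "a = \<bar>\<alpha>\<bar>"
  have a: "a > 0" using False by (simp add: a_def)
  let ?T = "\<lambda>\<alpha>. integral {0..1} (\<lambda>y. cos (\<beta> * y) * sin (\<alpha> * lp_arc p y))"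
  \<comment> \<open>Sine is odd, so the sign of \<open>\<alpha>\<close> affects only the sign of the
    integral.\<close>
  have "\<bar>?T \<alpha>\<bar> = \<bar>?T a\<bar>" unfolding a_def by (cases "\<alpha> \<ge> 0") auto
  also have "\<dots> \<le> 8 / sqrt (a * (p - 1))" by (rule integral_cos_sin_lp_arc_bound[OF p a])
  finally have T: "\<bar>?T \<alpha>\<bar> \<le> 8 / (sqrt a * sqrt (p - 1))" by (simp add: real_sqrt_mult)
  have "cmod (fourier2 (indicator (pball p)) (\<alpha>, \<beta>)) = 2 / (pi * a) * \<bar>?T \<alpha>\<bar>"
    using fourier2_pball[of p \<alpha> \<beta>] p False
    by (simp add: a_def abs_mult del: of_real_mult of_real_divide)
  also have "\<dots> \<le> 2 / (pi * a) * (8 / (sqrt a * sqrt (p - 1)))"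
    using a T by (intro mult_left_mono) auto
  finally have F: "cmod (fourier2 (indicator (pball p)) (\<alpha>, \<beta>))
      \<le> 2 / (pi * a) * (8 / (sqrt a * sqrt (p - 1)))" .
  have "\<beta>\<^sup>2 \<le> \<alpha>\<^sup>2" using ord by (simp add: abs_le_square_iff)
  then have "norm (\<alpha>, \<beta>) \<le> sqrt (2 * \<alpha>\<^sup>2)" by (simp add: norm_Pair)
  also have "\<dots> \<le> sqrt ((2 * a)\<^sup>2)" by (simp add: a_def)
  also have "\<dots> = 2 * a" unfolding real_sqrt_abs using a by simp
  finally have N: "norm (\<alpha>, \<beta>) \<le> 2 * a" .
  have root: "x powr (3/2) = x * sqrt x" if "x > 0" for x :: real
    using that powr_add[of x 1 "1/2"] by (simp add: powr_half_sqrt)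
  have "norm (\<alpha>, \<beta>) powr (3/2) \<le> (2 * a) powr (3/2)" using N by (intro powr_mono2) auto
  also have "\<dots> = (2 * sqrt 2) * (a * sqrt a)" using a by (simp add: root real_sqrt_mult)
  also have "\<dots> \<le> 3 * (a * sqrt a)"
  proof (rule mult_right_mono)
    have "sqrt 2 \<le> 3 / 2" by (rule real_le_lsqrt) (auto simp: power2_eq_square)
    then show "2 * sqrt 2 \<le> 3" by simp
  qed (use a in simp)
  finally have "norm (\<alpha>, \<beta>) powr (3/2) * cmod (fourier2 (indicator (pball p)) (\<alpha>, \<beta>))
     \<le> (3 * (a * sqrt a)) * (2 / (pi * a) * (8 / (sqrt a * sqrt (p - 1))))"
    using F a by (intro mult_mono) auto
  also have "\<dots> = (48 / pi) * (1 / sqrt (p - 1))" using a by (simp add: field_simps)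
  also have "\<dots> \<le> 16 * (1 / sqrt (p - 1))"
    using p pi_gt3 by (intro mult_right_mono) (auto simp: field_simps)
  finally show ?thesis by simp
qed

subsection \<open>The averaging kernel\<close>

text \<open>An unnormalised Fejer kernel. The integral form includes \<open>s = 0\<close>, where the
  closed formula \<open>(1 - cos (R * s)) / s\<^sup>2\<close> has a removable singularity.\<close>

definition fejer :: "real \<Rightarrow> real \<Rightarrow> real" where
  "fejer R s = integral {0..R} (\<lambda>t. (R - t) * cos (t * s))"

lemma fejer_eq:
  assumes "R \<ge> 0" "s \<noteq> 0" shows "fejer R s = (1 - cos (R * s)) / s\<^sup>2"
proof -
  let ?F = "\<lambda>t. (R - t) * sin (t * s) / s - cos (t * s) / s\<^sup>2"
  have "((\<lambda>t. (R - t) * cos (t * s)) has_integral ?F R - ?F 0) {0..R}"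
  proof (rule fundamental_theorem_of_calculus[OF assms(1)])
    fix t
    have "(?F has_real_derivative (R - t) * cos (t * s)) (at t within {0..R})"
      using assms(2) by (auto intro!: derivative_eq_intros simp: field_simps power2_eq_square)
    then show "(?F has_vector_derivative (R - t) * cos (t * s)) (at t within {0..R})"
      by (simp add: has_real_derivative_iff_has_vector_derivative)
  qed
  then show ?thesis unfolding fejer_def using assms by (simp add: integral_unique diff_divide_distrib)
qed

text \<open>Away from 0 the kernel is bounded independently of \<open>R\<close>, so the non-resonant
  terms below stay bounded as \<open>R\<close> grows.\<close>

lemma fejer_le:
  assumes "R \<ge> 0" "0 < d" "d \<le> s" shows "fejer R s \<le> 2 / d\<^sup>2"
proof -
  have "fejer R s \<le> 2 / s\<^sup>2"
    using assms cos_ge_minus_one[of "R * s"] by (simp add: fejer_eq divide_right_mono)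
  also have "\<dots> \<le> 2 / d\<^sup>2" using assms by (intro divide_left_mono power_mono) auto
  finally show ?thesis .
qed

text \<open>For \<open>s \<le> 1 / R\<close> the argument \<open>t * s\<close> stays below 1, hence
  below \<open>pi / 3\<close>, so the cosine is at least 1/2 and the kernel is at least half the
  integral of \<open>R - t\<close>.\<close>

lemma fejer_ge:
  assumes "R > 0" "0 \<le> s" "s \<le> 1 / R" shows "fejer R s \<ge> R\<^sup>2 / 4"
proof -
  let ?F = "\<lambda>t. (R * t - t\<^sup>2 / 2) / 2"
  have "((\<lambda>t. (R - t) * (1/2)) has_integral ?F R - ?F 0) {0..R}"
  proof (rule fundamental_theorem_of_calculus)
    fix t
    have "(?F has_real_derivative (R - t) * (1/2)) (at t within {0..R})"
      by (auto intro!: derivative_eq_intros simp: field_simps)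
    then show "(?F has_vector_derivative (R - t) * (1/2)) (at t within {0..R})"
      by (simp add: has_real_derivative_iff_has_vector_derivative)
  qed (use assms in simp)
  moreover have "((\<lambda>t. (R - t) * cos (t * s)) has_integral fejer R s) {0..R}"
    unfolding fejer_def by (intro integrable_integral integrable_continuous_real continuous_intros)
  ultimately have "?F R - ?F 0 \<le> fejer R s"
  proof (rule has_integral_le)
    fix t assume t: "t \<in> {0..R}"
    have "t * s \<le> R * (1 / R)" using t assms by (intro mult_mono) auto
    then have "t * s \<le> pi / 3" using assms pi_gt3 by simp
    then have "cos (pi / 3) \<le> cos (t * s)" using t assms pi_gt3 by (intro cos_monotone_0_pi_le) auto
    then show "(R - t) * (1/2) \<le> (R - t) * cos (t * s)"
      using t by (intro mult_left_mono) (auto simp: cos_60)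
  qed
  then show ?thesis by (simp add: power2_eq_square)
qed

lemma fejer_nonneg:
  assumes "R > 0" shows "fejer R s \<ge> 0"
proof (cases "s = 0")
  case True
  have "R\<^sup>2 / 4 \<le> fejer R s" using fejer_ge[OF assms, of s] assms True by simp
  then show ?thesis using zero_le_power2[of R] by linarith
next
  case False
  then show ?thesis using assms by (simp add: fejer_eq)
qed

text \<open>Product-to-sum for three factors. With \<open>M\<close> the maximum of
  \<open>h + y\<close>, the term at \<open>M - h - y\<close> is the resonant one.\<close>

lemma integral_weighted_sin_sin_cos:
  "integral {0..R} (\<lambda>t. (R - t) * sin (t * M) * (cos (t * y) * sin (t * h)))
   = (fejer R (M - h - y) + fejer R (M - h + y) - fejer R (M + h - y) - fejer R (M + h + y)) / 4"
proof -
  have F: "((\<lambda>t. (R - t) * cos (t * s)) has_integral fejer R s) {0..R}" for s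
    unfolding fejer_def by (intro integrable_integral integrable_continuous_real continuous_intros)
  have "((\<lambda>t. ((R - t) * cos (t * (M - h - y)) + (R - t) * cos (t * (M - h + y))
        - (R - t) * cos (t * (M + h - y)) - (R - t) * cos (t * (M + h + y))) / 4) has_integral
     (fejer R (M - h - y) + fejer R (M - h + y) - fejer R (M + h - y) - fejer R (M + h + y)) / 4) {0..R}"
    by (intro has_integral_divide has_integral_diff has_integral_add F)
  moreover have "((R - t) * cos (t * (M - h - y)) + (R - t) * cos (t * (M - h + y))
        - (R - t) * cos (t * (M + h - y)) - (R - t) * cos (t * (M + h + y))) / 4
      = (R - t) * sin (t * M) * (cos (t * y) * sin (t * h))" for t
    by (simp add: cos_add cos_diff sin_add sin_diff field_simps)
  ultimately show ?thesis by (simp add: integral_unique)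
qed

subsection \<open>Lower bound on the diagonal\<close>

text \<open>The curvature bound in the opposite direction, on a window left of the diagonal point:
  there \<open>y\<close> is at least 1/4 and \<open>1 - y powr p\<close> at least 1/2, so each of
  the two powers is at most 4.\<close>

lemma lp_arc_second_derivative_ge:
  fixes p y :: real
  assumes "1 < p" "p \<le> 2" "y > 0" "1/4 \<le> y powr p" "y powr p \<le> 1/2"
  shows "- ((p - 1) * y powr (p - 2) * (1 - y powr p) powr (1 / p - 2)) \<ge> - (16 * (p - 1))"
proof -
  let ?u = "1 - y powr p"
  have "y < 1"
  proof (rule ccontr)
    assume "\<not> y < 1"
    then have "y powr p \<ge> 1" using assms by (intro ge_one_powr_ge_zero) auto
    with assms show False by simp
  qed
  then have "y powr p \<le> y powr 1" using assms by (intro powr_mono') auto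
  then have y: "1/4 \<le> y" using assms by simp
  have "y powr (p - 2) \<le> (1/4) powr (p - 2)" using y assms by (intro powr_mono2') auto
  also have "\<dots> \<le> (1/4) powr (-1)" using assms by (intro powr_mono') auto
  finally have 1: "y powr (p - 2) \<le> 4" by (simp add: powr_minus)
  have "0 < 1 / p" "1 / p \<le> 1" using assms by auto
  then have "1 / p - 2 \<le> 0" by linarith
  then have "?u powr (1 / p - 2) \<le> (1/2) powr (1 / p - 2)" by (rule powr_mono2') (use assms in auto)
  also have "\<dots> \<le> (1/2) powr (-2)" using \<open>0 < 1 / p\<close> by (intro powr_mono') auto
  finally have 2: "?u powr (1 / p - 2) \<le> 4" by (simp add: powr_minus powr_numeral power2_eq_square)
  have "y powr (p - 2) * ?u powr (1 / p - 2) \<le> 4 * 4" using 1 2 by (intro mult_mono) auto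
  then have "(p - 1) * (y powr (p - 2) * ?u powr (1 / p - 2)) \<le> (p - 1) * 16"
    using assms by (intro mult_left_mono) auto
  then show ?thesis by (simp add: mult.assoc)
qed

text \<open>A second-order Taylor estimate at the diagonal point \<open>y\<^sub>0\<close>, where
  \<open>lp_arc p y + y\<close> has the value \<open>2 * y\<^sub>0\<close> and slope 0. The mean
  value theorem is applied twice, with second derivative between \<open>- 16 * (p - 1)\<close> and
  0; the Taylor factor 1/2 is given away.\<close>

lemma lp_arc_gap:
  fixes p y :: real
  defines "y\<^sub>0 \<equiv> (1/2) powr (1 / p)"
  assumes "1 < p" "p \<le> 2" "(1/4) powr (1 / p) \<le> y" "y \<le> y\<^sub>0"
  shows "0 \<le> 2 * y\<^sub>0 - lp_arc p y - y" "2 * y\<^sub>0 - lp_arc p y - y \<le> 16 * (p - 1) * (y\<^sub>0 - y)\<^sup>2"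
proof -
  define g where "g = (\<lambda>y. lp_arc p y + y)"
  define g' where "g' = (\<lambda>y. - ((1 - y powr p) powr (1 / p - 1) * y powr (p - 1)) + 1)"
  define g'' where "g'' = (\<lambda>y. - ((p - 1) * y powr (p - 2) * (1 - y powr p) powr (1 / p - 2)))"
  have y0: "y\<^sub>0 powr p = 1/2" "y\<^sub>0 > 0" using assms by (auto simp: y\<^sub>0_def powr_powr)
  have g0: "g y\<^sub>0 = 2 * y\<^sub>0" unfolding g_def lp_arc_def y0 by (simp add: y\<^sub>0_def)
  have pos: "0 < (1/4::real) powr (1 / p)" by simp
  have window: "0 < z" "z < 1" "1/4 \<le> z powr p" "z powr p \<le> 1/2"
    if "(1/4) powr (1 / p) \<le> z" "z \<le> y\<^sub>0" for z
  proof -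
    show "0 < z" using pos that by linarith
    have "((1/4) powr (1 / p)) powr p \<le> z powr p" using that assms by (intro powr_mono2) auto
    then show "1/4 \<le> z powr p" using assms by (simp add: powr_powr)
    show "z powr p \<le> 1/2" using powr_mono2[of p z y\<^sub>0] that assms y0 \<open>0 < z\<close> by simp
    have "y\<^sub>0 < 1" unfolding y\<^sub>0_def using assms by (intro powr_less_one_of_less_one) auto
    then show "z < 1" using that by simp
  qed
  have dg: "(g has_real_derivative g' z) (at z)" and dg': "(g' has_real_derivative g'' z) (at z)"
    if "(1/4) powr (1 / p) \<le> z" "z \<le> y\<^sub>0" for z
    unfolding g_def g'_def g''_def using window[OF that] assms
      DERIV_add[OF lp_arc_has_derivative[of p z] DERIV_ident]
      DERIV_add[OF lp_arc_has_second_derivative[of p z] DERIV_const[of 1]] by auto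
  \<comment> \<open>Both bases are powers of 1/2 at \<open>y\<^sub>0\<close>, and the exponents
    \<open>1 / p - 1\<close> and \<open>1 - 1 / p\<close> cancel.\<close>
  have g'0: "g' y\<^sub>0 = 0"
  proof -
    have "y\<^sub>0 powr (p - 1) = (1/2) powr (1 - 1 / p)"
      using assms by (simp add: y\<^sub>0_def powr_powr diff_divide_distrib)
    then have "(1 - y\<^sub>0 powr p) powr (1 / p - 1) * y\<^sub>0 powr (p - 1) = 1"
      by (simp add: y0 flip: powr_add)
    then show ?thesis by (simp add: g'_def)
  qed
  have slope: "0 \<le> g' z" "g' z \<le> 16 * (p - 1) * (y\<^sub>0 - z)"
    if z: "(1/4) powr (1 / p) \<le> z" "z < y\<^sub>0" for z
  proof -
    obtain w where w: "z < w" "w < y\<^sub>0" "g' y\<^sub>0 - g' z = (y\<^sub>0 - z) * g'' w"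
      using MVT2[OF z(2), of g' g''] dg' z by auto
    have ww: "(1/4) powr (1 / p) \<le> w" "w \<le> y\<^sub>0" using w z by auto
    have "g'' w \<le> 0" "- g'' w \<le> 16 * (p - 1)"
      using lp_arc_second_derivative_le[of p w] lp_arc_second_derivative_ge[of p w] window[OF ww] assms
      unfolding g''_def by linarith+
    then have "0 \<le> (y\<^sub>0 - z) * - g'' w" "(y\<^sub>0 - z) * - g'' w \<le> (y\<^sub>0 - z) * (16 * (p - 1))"
      using z by (intro mult_nonneg_nonneg mult_left_mono; simp)+
    moreover have "g' z = (y\<^sub>0 - z) * - g'' w" using w(3) g'0 by simp
    ultimately show "0 \<le> g' z" "g' z \<le> 16 * (p - 1) * (y\<^sub>0 - z)" by (simp_all add: mult.commute)
  qed
  have "0 \<le> g y\<^sub>0 - g y \<and> g y\<^sub>0 - g y \<le> 16 * (p - 1) * (y\<^sub>0 - y)\<^sup>2"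
  proof (cases "y = y\<^sub>0")
    case False
    then have lt: "y < y\<^sub>0" using assms by simp
    obtain z where z: "y < z" "z < y\<^sub>0" "g y\<^sub>0 - g y = (y\<^sub>0 - y) * g' z"
      using MVT2[OF lt, of g g'] dg assms(4) by auto
    have sl: "0 \<le> g' z" "g' z \<le> 16 * (p - 1) * (y\<^sub>0 - z)" using slope[of z] z assms(4) by auto
    have "16 * (p - 1) * (y\<^sub>0 - z) \<le> 16 * (p - 1) * (y\<^sub>0 - y)"
      using z assms by (intro mult_left_mono) auto
    then have "(y\<^sub>0 - y) * g' z \<le> (y\<^sub>0 - y) * (16 * (p - 1) * (y\<^sub>0 - y))"
      using sl lt by (intro mult_left_mono) auto
    moreover have "0 \<le> (y\<^sub>0 - y) * g' z" using sl lt by simp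
    ultimately show ?thesis unfolding z(3) by (simp add: power2_eq_square algebra_simps)
  qed simp
  then show "0 \<le> 2 * y\<^sub>0 - lp_arc p y - y" "2 * y\<^sub>0 - lp_arc p y - y \<le> 16 * (p - 1) * (y\<^sub>0 - y)\<^sup>2"
    unfolding g0 by (simp_all add: g_def)
qed

text \<open>After exchanging the integrals, the integral in \<open>t\<close> is a combination of
  four Fejer kernels. The resonant one is at least \<open>R\<^sup>2 / 4\<close> on an interval of
  length \<open>l\<close>, which with the factor 1/4 gives the main term. The two subtracted kernels
  cost a constant independent of \<open>R\<close>.\<close>

lemma lp_arc_fejer_lower_bound:
  fixes p R l :: real
  defines "y\<^sub>0 \<equiv> (1/2) powr (1 / p)"
  assumes p: "1 < p" "p \<le> 2" and R: "R > 0"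
    and l: "0 \<le> l" "(1/4) powr (1 / p) \<le> y\<^sub>0 - l" "16 * (p - 1) * l\<^sup>2 \<le> 1 / R"
  shows "R\<^sup>2 * l / 16 - 1 / (2 * y\<^sub>0 - 1)\<^sup>2
    \<le> integral {0..R} (\<lambda>t. (R - t) * sin (t * (2 * y\<^sub>0))
         * integral {0..1} (\<lambda>y. cos (t * y) * sin (t * lp_arc p y)))"
proof -
  define M where "M = 2 * y\<^sub>0"
  define f where "f t y = (R - t) * sin (t * M) * (cos (t * y) * sin (t * lp_arc p y))" for t y
  define G where "G y = integral {0..R} (\<lambda>t. f t y)" for y
  \<comment> \<open>Strictness \<open>p > 1\<close> gives \<open>M > 1\<close>, which keeps the
    arguments \<open>M + lp_arc p y - y\<close> and \<open>M + lp_arc p y + y\<close> at distance at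
    least \<open>M - 1\<close> from 0.\<close>
  have "(1/2) powr 1 < (1/2::real) powr (1 / p)" using p by (intro powr_less_mono') auto
  then have M: "M > 1" by (simp add: M_def y\<^sub>0_def)
  have y0: "y\<^sub>0 < 1" unfolding y\<^sub>0_def using p by (intro powr_less_one_of_less_one) auto
  have "0 < (1/4::real) powr (1 / p)" by simp
  then have l0: "0 \<le> y\<^sub>0 - l" using l by linarith
  have h: "0 \<le> lp_arc p y" "lp_arc p y \<le> 1" if "y \<in> {0..1}" for y
    using lp_arc_nonneg lp_arc_le_1[of p y] p that by auto
  have cont: "continuous_on (A \<times> {0..1}) (\<lambda>(t, y). f t y)" for A
    unfolding f_def case_prod_beta using p
    by (intro continuous_intros continuous_on_compose2[OF continuous_on_lp_arc[of p]]) auto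
  have cont': "continuous_on ({0..1} \<times> A) (\<lambda>(y, t). f t y)" for A
    unfolding f_def case_prod_beta using p
    by (intro continuous_intros continuous_on_compose2[OF continuous_on_lp_arc[of p]]) auto
  have "integral {0..R} (\<lambda>t. (R - t) * sin (t * M) * integral {0..1} (\<lambda>y. cos (t * y) * sin (t * lp_arc p y)))
      = integral {0..R} (\<lambda>t. integral {0..1} (f t))"
    unfolding f_def by simp
  also have "\<dots> = integral {0..1} G"
    using integral_swap_continuous[of 0 0 R 1 f] cont[of "{0..R}"] unfolding G_def
    by (simp add: cbox_Pair_eq)
  finally have swap: "integral {0..R} (\<lambda>t. (R - t) * sin (t * M)
      * integral {0..1} (\<lambda>y. cos (t * y) * sin (t * lp_arc p y))) = integral {0..1} G" .
  have G_eq: "G y = (fejer R (M - lp_arc p y - y) + fejer R (M - lp_arc p y + y)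
       - fejer R (M + lp_arc p y - y) - fejer R (M + lp_arc p y + y)) / 4" for y
    unfolding G_def f_def by (rule integral_weighted_sin_sin_cos)
  have G_ge: "G y \<ge> fejer R (M - lp_arc p y - y) / 4 - 1 / (M - 1)\<^sup>2" if y: "y \<in> {0..1}" for y
  proof -
    have "fejer R (M + lp_arc p y - y) \<le> 2 / (M - 1)\<^sup>2" "fejer R (M + lp_arc p y + y) \<le> 2 / (M - 1)\<^sup>2"
      using h[OF y] y M R by (auto intro!: fejer_le)
    then show ?thesis using fejer_nonneg[OF R, of "M - lp_arc p y + y"] unfolding G_eq by argo
  qed
  have G_int: "G integrable_on {0..1}"
    unfolding G_def
    using integral_continuous_on_param[of "{0..1}" 0 R "\<lambda>y t. f t y"] cont'[of "{0..R}"]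
    by (intro integrable_continuous_real) simp
  \<comment> \<open>A step-function minorant of \<open>G\<close>: outside the interval next to
    \<open>y\<^sub>0\<close> only nonnegativity of the resonant kernel is used.\<close>
  let ?low = "\<lambda>y. (if y \<in> {y\<^sub>0 - l..y\<^sub>0} then R\<^sup>2 / 16 else 0) - 1 / (M - 1)\<^sup>2"
  have "((\<lambda>y. R\<^sup>2 / 16) has_integral R\<^sup>2 * l / 16) {y\<^sub>0 - l..y\<^sub>0}"
    using has_integral_const_real[of "R\<^sup>2 / 16" "y\<^sub>0 - l" y\<^sub>0] l by (simp add: mult.commute)
  then have "((\<lambda>y. if y \<in> {y\<^sub>0 - l..y\<^sub>0} then R\<^sup>2 / 16 else 0) has_integral R\<^sup>2 * l / 16) {0..1}"
    using l0 y0 by (subst has_integral_restrict) auto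
  moreover have "((\<lambda>y::real. 1 / (M - 1)\<^sup>2) has_integral 1 / (M - 1)\<^sup>2) {0..1}"
    using has_integral_const_real[of "1 / (M - 1)\<^sup>2" 0 1] by simp
  ultimately have "(?low has_integral R\<^sup>2 * l / 16 - 1 / (M - 1)\<^sup>2) {0..1}"
    by (rule has_integral_diff)
  then have "R\<^sup>2 * l / 16 - 1 / (M - 1)\<^sup>2 \<le> integral {0..1} G"
  proof (rule has_integral_le[OF _ integrable_integral[OF G_int]])
    fix y :: real assume y: "y \<in> {0..1}"
    show "?low y \<le> G y"
    proof (cases "y \<in> {y\<^sub>0 - l..y\<^sub>0}")
      case True
      have "0 \<le> M - lp_arc p y - y" "M - lp_arc p y - y \<le> 16 * (p - 1) * (y\<^sub>0 - y)\<^sup>2"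
        using lp_arc_gap[OF p, of y] True l unfolding M_def y\<^sub>0_def by auto
      moreover have "16 * (p - 1) * (y\<^sub>0 - y)\<^sup>2 \<le> 16 * (p - 1) * l\<^sup>2"
        using True p by (intro mult_left_mono power_mono) auto
      ultimately have "R\<^sup>2 / 4 \<le> fejer R (M - lp_arc p y - y)"
        using l R by (intro fejer_ge) auto
      with G_ge[OF y] True show ?thesis by simp
    next
      case False
      with G_ge[OF y] fejer_nonneg[OF R, of "M - lp_arc p y - y"] show ?thesis by auto
    qed
  qed
  then show ?thesis using swap by (simp add: M_def)
qed

text \<open>The weight is at most \<open>R\<close> in absolute value. The part up to
  \<open>A\<close> is bounded trivially by \<open>R * A\<close>, and beyond \<open>A\<close> the
  integral of \<open>\<kappa> / sqrt t\<close> is at most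
  \<open>2 * \<kappa> * sqrt R\<close>.\<close>

lemma weighted_integral_le_of_sqrt_decay:
  fixes S :: "real \<Rightarrow> real"
  assumes A: "0 < A" "A \<le> R" and "\<kappa> \<ge> 0"
    and cont: "continuous_on {0..R} S"
    and le: "\<And>t. t \<in> {0..A} \<Longrightarrow> \<bar>S t\<bar> \<le> 1"
    and decay: "\<And>t. t \<ge> A \<Longrightarrow> \<bar>S t\<bar> \<le> \<kappa> / sqrt t"
  shows "integral {0..R} (\<lambda>t. (R - t) * sin (t * M) * S t) \<le> R * A + 2 * \<kappa> * R * sqrt R"
proof -
  let ?g = "\<lambda>t. (R - t) * sin (t * M) * S t"
  have int: "?g integrable_on {0..R}"
    by (intro integrable_continuous_real continuous_intros cont)
  have g_le: "?g t \<le> R * \<bar>S t\<bar>" if "t \<in> {0..R}" for t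
  proof -
    have "?g t \<le> \<bar>?g t\<bar>" by simp
    also have "\<dots> = \<bar>R - t\<bar> * \<bar>sin (t * M)\<bar> * \<bar>S t\<bar>" by (simp add: abs_mult)
    also have "\<dots> \<le> R * 1 * \<bar>S t\<bar>" using that by (intro mult_right_mono mult_mono) auto
    finally show ?thesis by simp
  qed
  have "integral {0..A} ?g \<le> R * A"
  proof -
    have "integral {0..A} ?g \<le> integral {0..A} (\<lambda>t. R)"
    proof (rule integral_le)
      show "?g integrable_on {0..A}" by (rule integrable_subinterval_real[OF int]) (use A in auto)
      fix t assume t: "t \<in> {0..A}"
      have "R * \<bar>S t\<bar> \<le> R * 1" using le[OF t] A by (intro mult_left_mono) auto
      moreover have "?g t \<le> R * \<bar>S t\<bar>" using t A by (intro g_le) auto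
      ultimately show "?g t \<le> R" by linarith
    qed auto
    then show ?thesis using A by (simp add: mult.commute)
  qed
  moreover have "integral {A..R} ?g \<le> 2 * \<kappa> * R * sqrt R"
  proof -
    let ?F = "\<lambda>t. 2 * \<kappa> * R * sqrt t"
    have F: "((\<lambda>t. R * (\<kappa> / sqrt t)) has_integral ?F R - ?F A) {A..R}"
    proof (rule fundamental_theorem_of_calculus[OF A(2)])
      fix t assume t: "t \<in> {A..R}"
      have "(?F has_real_derivative R * (\<kappa> / sqrt t)) (at t within {A..R})"
        using t A by (auto intro!: derivative_eq_intros simp: field_simps)
      then show "(?F has_vector_derivative R * (\<kappa> / sqrt t)) (at t within {A..R})"
        by (simp add: has_real_derivative_iff_has_vector_derivative)
    qed
    have "integral {A..R} ?g \<le> integral {A..R} (\<lambda>t. R * (\<kappa> / sqrt t))"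
    proof (rule integral_le)
      show "?g integrable_on {A..R}" by (rule integrable_subinterval_real[OF int]) (use A in auto)
      show "(\<lambda>t. R * (\<kappa> / sqrt t)) integrable_on {A..R}" using F by blast
      fix t assume t: "t \<in> {A..R}"
      have "R * \<bar>S t\<bar> \<le> R * (\<kappa> / sqrt t)" using decay[of t] t A by (intro mult_left_mono) auto
      then show "?g t \<le> R * (\<kappa> / sqrt t)" using g_le[of t] t A by simp
    qed
    also have "\<dots> = ?F R - ?F A" by (rule integral_unique[OF F])
    also have "\<dots> \<le> 2 * \<kappa> * R * sqrt R" using assms by simp
    finally show ?thesis .
  qed
  moreover have "integral {0..A} ?g + integral {A..R} ?g = integral {0..R} ?g"
    by (rule Henstock_Kurzweil_Integration.integral_combine) (use A int in auto)
  ultimately show ?thesis by linarith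
qed

text \<open>If the integral were bounded by \<open>\<kappa> / sqrt \<alpha>\<close> for all large
  \<open>\<alpha>\<close>, the weighted average would be at most
  \<open>R * A + R * r / (128 * q)\<close> with \<open>r = sqrt R\<close>. The Fejer bound makes it
  at least \<open>R * r / (64 * q) - K\<close>, which is impossible for large
  \<open>r\<close>.\<close>

lemma lp_arc_integral_not_small:
  assumes p: "1 < p" "p < 2"
  shows "\<exists>\<alpha>\<ge>B. 1 / (256 * sqrt (p - 1)) < sqrt \<alpha> *
    \<bar>integral {0..1} (\<lambda>y. cos (\<alpha> * y) * sin (\<alpha> * lp_arc p y))\<bar>"
proof (rule ccontr)
  define S where "S \<alpha> = integral {0..1} (\<lambda>y. cos (\<alpha> * y) * sin (\<alpha> * lp_arc p y))" for \<alpha>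
  define q where "q = sqrt (p - 1)"
  \<comment> \<open>Chosen so that the main term of the upper bound is exactly half that of the
    lower bound.\<close>
  define \<kappa> where "\<kappa> = 1 / (256 * q)"
  define y\<^sub>0 where "y\<^sub>0 = (1/2) powr (1 / p)"
  define w where "w = y\<^sub>0 - (1/4) powr (1 / p)"
  define K where "K = 1 / (2 * y\<^sub>0 - 1)\<^sup>2"
  define A where "A = max B 1"
  assume "\<not> ?thesis"
  then have small: "sqrt \<alpha> * \<bar>S \<alpha>\<bar> \<le> \<kappa>" if "\<alpha> \<ge> A" for \<alpha>
    using that unfolding S_def \<kappa>_def q_def A_def by force
  have q: "0 < q" "q < 1" "q\<^sup>2 = p - 1" using p by (auto simp: q_def)
  have w: "w > 0" unfolding w_def y\<^sub>0_def using p powr_less_mono2[of "1/p" "1/4" "1/2"] by simp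
  have "K \<ge> 0" by (simp add: K_def)
  have A: "A \<ge> 1" by (simp add: A_def)
  define u where "u = 1 / (4 * q * w)"
  \<comment> \<open>The summand \<open>128 * (A + K)\<close> yields the final contradiction, and
    \<open>u\<close> makes \<open>l \<le> w\<close>, so that the interval of length \<open>l\<close>
    fits into the window where the gap estimate holds.\<close>
  define r where "r = A + K + 128 * (A + K) + u"
  define R where "R = r\<^sup>2"
  have r: "r \<ge> A" "r > 128 * (A + K)" "r \<ge> 1 / (4 * q * w)"
  proof -
    have "u > 0" using q w by (simp add: u_def)
    then show "r \<ge> A" "r > 128 * (A + K)" "r \<ge> 1 / (4 * q * w)"
      unfolding r_def u_def[symmetric] using A \<open>K \<ge> 0\<close> by auto
  qed
  have r1: "r \<ge> 1" using r A by linarith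
  have "A \<le> r * r" using r r1 mult_mono[of 1 r A r] A by simp
  then have R: "R > 0" "A \<le> R" "sqrt R = r" using r1 by (auto simp: R_def power2_eq_square)
  \<comment> \<open>The largest length satisfying
    \<open>16 * (p - 1) * l\<^sup>2 \<le> 1 / R\<close>; equality holds.\<close>
  define l where "l = 1 / (4 * q * r)"
  have "l > 0" using q r1 by (simp add: l_def)
  have "1 \<le> r * (4 * q * w)" using r(3) q w by (simp add: pos_divide_le_eq)
  then have "l \<le> w" using q r1 by (simp add: l_def pos_divide_le_eq mult_ac)
  have "16 * (p - 1) * l\<^sup>2 = 1 / R"
    unfolding q(3)[symmetric] l_def R_def using q r1 by (simp add: field_simps)
  then have "R\<^sup>2 * l / 16 - K \<le> integral {0..R} (\<lambda>t. (R - t) * sin (t * (2 * y\<^sub>0)) * S t)"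
    unfolding K_def S_def y\<^sub>0_def
    by (intro lp_arc_fejer_lower_bound) (use p R \<open>l > 0\<close> \<open>l \<le> w\<close> in \<open>auto simp: w_def y\<^sub>0_def\<close>)
  also have "\<dots> \<le> R * A + 2 * \<kappa> * R * sqrt R"
  proof (rule weighted_integral_le_of_sqrt_decay)
    have "continuous_on ({0..R} \<times> cbox 0 1) (\<lambda>(t, y). cos (t * y) * sin (t * lp_arc p y))"
      unfolding case_prod_beta using p
      by (intro continuous_intros continuous_on_compose2[OF continuous_on_lp_arc[of p]]) auto
    from integral_continuous_on_param[OF this] show "continuous_on {0..R} S"
      by (simp add: S_def[abs_def])
    show "\<bar>S t\<bar> \<le> 1" for t
    proof -
      have "norm (S t) \<le> integral {0..1} (\<lambda>y::real. 1)"
        unfolding S_def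
      proof (rule integral_norm_bound_integral)
        fix y :: real
        have "\<bar>cos (t * y)\<bar> * \<bar>sin (t * lp_arc p y)\<bar> \<le> 1 * 1" by (intro mult_mono) auto
        then show "norm (cos (t * y) * sin (t * lp_arc p y)) \<le> 1" by (simp add: abs_mult)
      qed (use p in \<open>auto intro!: integrable_continuous_real continuous_on_cos_sin_lp_arc\<close>)
      then show ?thesis by simp
    qed
    show "\<bar>S t\<bar> \<le> \<kappa> / sqrt t" if "t \<ge> A" for t
      using small[OF that] that A by (simp add: field_simps)
  qed (use A R q in \<open>auto simp: \<kappa>_def\<close>)
  finally have "R\<^sup>2 * l / 16 - K \<le> R * A + 2 * \<kappa> * R * r" unfolding R .
  moreover have "R\<^sup>2 * l / 16 = R * (r / (64 * q))"
    unfolding l_def R_def using q r1 by (simp add: field_simps power2_eq_square)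
  moreover have "2 * \<kappa> * R * r = R * (r / (128 * q))" by (simp add: \<kappa>_def)
  moreover have "R * (r / (64 * q)) = R * (r / (128 * q)) + R * (r / (128 * q))" by simp
  ultimately have "R * (r / (128 * q)) \<le> R * A + K" by linarith
  also have "\<dots> \<le> R * A + R * K"
    using \<open>K \<ge> 0\<close> A R by (simp add: mult_le_cancel_right1)
  finally have "R * (r / (128 * q)) \<le> R * (A + K)" by (simp add: algebra_simps)
  then have "r / (128 * q) \<le> A + K" using R by (simp only: mult_le_cancel_left_pos)
  moreover have "r / 128 \<le> r / (128 * q)" using q r1 by (intro divide_left_mono) auto
  ultimately have "r / 128 \<le> A + K" by (rule order_trans[rotated])
  then show False using r(2) by simp
qed

text \<open>The norm of \<open>(\<alpha>, \<alpha>)\<close> is at least \<open>\<alpha>\<close>,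
  which absorbs the factor \<open>1 / \<alpha>\<close> of the transform, and \<open>2 / pi\<close>
  is at least 1/2.\<close>

lemma fourier2_pball_diagonal:
  assumes "p > 0" "\<alpha> > 0"
  shows "norm (\<alpha>, \<alpha>) powr (3/2) * cmod (fourier2 (indicator (pball p)) (\<alpha>, \<alpha>))
    \<ge> (1/2) * (sqrt \<alpha> * \<bar>integral {0..1} (\<lambda>y. cos (\<alpha> * y) * sin (\<alpha> * lp_arc p y))\<bar>)"
proof -
  let ?S = "integral {0..1} (\<lambda>y. cos (\<alpha> * y) * sin (\<alpha> * lp_arc p y))"
  have "\<alpha> * sqrt \<alpha> = \<alpha> powr (3/2)"
    using assms powr_add[of \<alpha> 1 "1/2"] by (simp add: powr_half_sqrt)
  also have "\<dots> \<le> norm (\<alpha>, \<alpha>) powr (3/2)"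
    using assms norm_fst_le[of \<alpha> \<alpha>] by (intro powr_mono2) auto
  finally have N: "\<alpha> * sqrt \<alpha> \<le> norm (\<alpha>, \<alpha>) powr (3/2)" .
  have F: "cmod (fourier2 (indicator (pball p)) (\<alpha>, \<alpha>)) = 2 / (pi * \<alpha>) * \<bar>?S\<bar>"
    using fourier2_pball[of p \<alpha> \<alpha>] assms by (simp add: abs_mult del: of_real_mult of_real_divide)
  have "(1/2) * (sqrt \<alpha> * \<bar>?S\<bar>) \<le> (2 / pi) * (sqrt \<alpha> * \<bar>?S\<bar>)"
    using assms pi_less_4 by (intro mult_right_mono) (auto simp: field_simps)
  also have "\<dots> = (\<alpha> * sqrt \<alpha>) * (2 / (pi * \<alpha>) * \<bar>?S\<bar>)" using assms by (simp add: field_simps)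
  also have "\<dots> \<le> norm (\<alpha>, \<alpha>) powr (3/2) * (2 / (pi * \<alpha>) * \<bar>?S\<bar>)"
    using assms by (intro mult_right_mono N) auto
  finally show ?thesis unfolding F .
qed

theorem theorem3p1:
  shows "(\<exists>C\<^sub>1::real. C\<^sub>1 > 0 \<and>
           (\<forall>p::real. 1 < p \<and> p \<le> 2 \<longrightarrow>
              (SUP \<omega>::real \<times> real.
                 ereal (pnorm 2 \<omega> powr (3 / 2) * cmod (fourier2 (indicator (pball p)) \<omega>)))
              \<le> ereal (C\<^sub>1 / sqrt (p - 1))))
       \<and> (\<exists>C\<^sub>2::real. C\<^sub>2 > 0 \<and>
           (\<forall>p::real. 1 < p \<and> p < 2 \<longrightarrow>
              (\<exists>(\<omega> :: nat \<Rightarrow> real \<times> real) (\<epsilon> :: nat \<Rightarrow> real).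
                 filterlim (\<lambda>n. pnorm 2 (\<omega> n)) at_top sequentially \<and>
                 \<epsilon> \<longlonglongrightarrow> 0 \<and>
                 (\<forall>n. pnorm 2 (\<omega> n) powr (3 / 2) * cmod (fourier2 (indicator (pball p)) (\<omega> n))
                      \<ge> C\<^sub>2 / sqrt (p - 1) + \<epsilon> n))))"
proof (rule conjI)
  have "(SUP \<omega>::real \<times> real.
       ereal (pnorm 2 \<omega> powr (3 / 2) * cmod (fourier2 (indicator (pball p)) \<omega>)))
     \<le> ereal (16 / sqrt (p - 1))" if p: "1 < p" "p \<le> 2" for p
  proof (rule SUP_least)
    fix \<omega> :: "real \<times> real"
    obtain \<alpha> \<beta> where [simp]: "\<omega> = (\<alpha>, \<beta>)" by fastforce
    have "norm (\<alpha>, \<beta>) powr (3/2) * cmod (fourier2 (indicator (pball p)) (\<alpha>, \<beta>)) \<le> 16 / sqrt (p - 1)"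
    proof (cases "\<bar>\<beta>\<bar> \<le> \<bar>\<alpha>\<bar>")
      case True
      then show ?thesis by (rule fourier2_pball_bound[OF p])
    next
      case False
      have "norm (\<alpha>, \<beta>) = norm (\<beta>, \<alpha>)" by (simp add: norm_Pair add.commute)
      with False fourier2_pball_bound[OF p, of \<alpha> \<beta>] show ?thesis
        by (simp add: fourier2_pball_swap[of p \<alpha> \<beta>])
    qed
    then show "ereal (pnorm 2 \<omega> powr (3 / 2) * cmod (fourier2 (indicator (pball p)) \<omega>))
        \<le> ereal (16 / sqrt (p - 1))"
      by (simp add: pnorm_2_eq_norm)
  qed
  then show "\<exists>C\<^sub>1::real. C\<^sub>1 > 0 \<and> (\<forall>p::real. 1 < p \<and> p \<le> 2 \<longrightarrow>
      (SUP \<omega>::real \<times> real.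
         ereal (pnorm 2 \<omega> powr (3 / 2) * cmod (fourier2 (indicator (pball p)) \<omega>)))
      \<le> ereal (C\<^sub>1 / sqrt (p - 1)))"
    by (intro exI[of _ 16]) simp
next
  have "\<exists>(\<omega> :: nat \<Rightarrow> real \<times> real) (\<epsilon> :: nat \<Rightarrow> real).
      filterlim (\<lambda>n. pnorm 2 (\<omega> n)) at_top sequentially \<and> \<epsilon> \<longlonglongrightarrow> 0 \<and>
      (\<forall>n. pnorm 2 (\<omega> n) powr (3 / 2) * cmod (fourier2 (indicator (pball p)) (\<omega> n))
           \<ge> (1/512) / sqrt (p - 1) + \<epsilon> n)" if p: "1 < p" "p < 2" for p
  proof -
    let ?S = "\<lambda>\<alpha>. integral {0..1} (\<lambda>y. cos (\<alpha> * y) * sin (\<alpha> * lp_arc p y))"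
    \<comment> \<open>The threshold \<open>Suc n\<close> makes the frequencies positive and forces
      them to infinity.\<close>
    have "\<forall>n. \<exists>\<alpha>\<ge>real (Suc n). 1 / (256 * sqrt (p - 1)) < sqrt \<alpha> * \<bar>?S \<alpha>\<bar>"
      using lp_arc_integral_not_small[OF p] by blast
    then obtain a where a: "\<And>n. a n \<ge> real (Suc n)"
      "\<And>n. 1 / (256 * sqrt (p - 1)) < sqrt (a n) * \<bar>?S (a n)\<bar>" by metis
    have a0: "a n > 0" for n using a(1)[of n] by simp
    have "filterlim (\<lambda>n. norm (a n, a n)) at_top sequentially"
    proof (rule filterlim_at_top_mono[OF filterlim_real_sequentially], intro always_eventually allI)
      show "real n \<le> norm (a n, a n)" for n
        using a(1)[of n] norm_fst_le[of "a n" "a n"] by simp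
    qed
    moreover have "(1/512) / sqrt (p - 1)
        \<le> norm (a n, a n) powr (3/2) * cmod (fourier2 (indicator (pball p)) (a n, a n))" for n
    proof -
      have "(1/512) / sqrt (p - 1) = (1/2) * (1 / (256 * sqrt (p - 1)))" by simp
      also have "\<dots> \<le> (1/2) * (sqrt (a n) * \<bar>?S (a n)\<bar>)" using a(2)[of n] by simp
      also have "\<dots> \<le> norm (a n, a n) powr (3/2) * cmod (fourier2 (indicator (pball p)) (a n, a n))"
        using p by (intro fourier2_pball_diagonal a0) simp
      finally show ?thesis .
    qed
    ultimately show ?thesis
      \<comment> \<open>The lower bound holds at every chosen frequency, so the error sequence can
        be taken to be 0.\<close>
      by (intro exI[of _ "\<lambda>n. (a n, a n)"] exI[of _ "\<lambda>_. 0"]) (simp add: pnorm_2_eq_norm)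
  qed
  then show "\<exists>C\<^sub>2::real. C\<^sub>2 > 0 \<and> (\<forall>p::real. 1 < p \<and> p < 2 \<longrightarrow>
      (\<exists>(\<omega> :: nat \<Rightarrow> real \<times> real) (\<epsilon> :: nat \<Rightarrow> real).
         filterlim (\<lambda>n. pnorm 2 (\<omega> n)) at_top sequentially \<and> \<epsilon> \<longlonglongrightarrow> 0 \<and>
         (\<forall>n. pnorm 2 (\<omega> n) powr (3 / 2) * cmod (fourier2 (indicator (pball p)) (\<omega> n))
              \<ge> C\<^sub>2 / sqrt (p - 1) + \<epsilon> n)))"
    by (intro exI[of _ "1/512"]) simp
qed

end
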